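(* Let $S(n,3)$ be the maximal size of a set $A\subseteq\mathbb{F}_3^n$ which does not contain distinct vectors $x,y$ with $\langle x-y,x-y\rangle=0$. For every positive integer $n\equiv 2 \pmod 3$ we have $$S(n,3)= \binom{n+3}{2}-1.$$
   Context: $\langle u,v\rangle=\sum_{i=1}^n u_iv_i$ denotes the standard dot product on $\mathbb{F}_3^n$. *)

theory Defs
  imports
    "Jordan_Normal_Form.Matrix"
    "HOL-Library.Cardinality"
    "HOL-Number_Theory.Cong"
begin

text \<open>The field with three elements is the library type \<^typ>\<open>Enum.finite_3\<close>: it is an instance of
  class \<open>field\<close>, and a field with exactly three elements is unique up to isomorphism.  Vectors
  are those of \<open>Jordan_Normal_Form\<close>, whose \<^const>\<open>scalar_prod\<close> is the plain sum of
  coordinatewise products.\<close>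

type_synonym F3 = Enum.finite_3

lemma card_F3: "CARD(F3) = 3"
  by (simp add: Enum.UNIV_finite_3)

definition no_isotropic_difference :: "F3 vec set \<Rightarrow> bool" where
  "no_isotropic_difference A \<longleftrightarrow>
     \<not> (\<exists>x\<in>A. \<exists>y\<in>A. x \<noteq> y \<and> scalar_prod (x - y) (x - y) = 0)"

definition S3 :: "nat \<Rightarrow> nat" where
  "S3 n = Max {card A | A. A \<subseteq> carrier_vec n \<and> no_isotropic_difference A}"

text \<open>\<^const>\<open>Max\<close> is only meaningful on finite nonempty sets.\<close>

lemma finite_carrier_vec_F3: "finite (carrier_vec n :: F3 vec set)"
proof -
  have "carrier_vec n \<subseteq> vec_of_list ` {xs :: F3 list. set xs \<subseteq> UNIV \<and> length xs = n}"
  proof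
    fix v :: "F3 vec" assume "v \<in> carrier_vec n"
    then have "length (list_of_vec v) = n" by simp
    moreover have "v = vec_of_list (list_of_vec v)" by (simp add: vec_list)
    ultimately show "v \<in> vec_of_list ` {xs :: F3 list. set xs \<subseteq> UNIV \<and> length xs = n}" by blast
  qed
  then show ?thesis by (rule finite_subset) (intro finite_imageI finite_lists_length_eq finite)
qed

lemma S3_Max_well_defined:
  "finite {card A | A. A \<subseteq> carrier_vec n \<and> no_isotropic_difference A}"
  "{card A | A. A \<subseteq> carrier_vec n \<and> no_isotropic_difference A} \<noteq> {}"
proof -
  have "{card A | A. A \<subseteq> carrier_vec n \<and> no_isotropic_difference A} \<subseteq> card ` Pow (carrier_vec n :: F3 vec set)"
    by auto
  then show "finite {card A | A. A \<subseteq> carrier_vec n \<and> no_isotropic_difference A}"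
    by (rule finite_subset) (simp add: finite_carrier_vec_F3)
  have "no_isotropic_difference {}" by (simp add: no_isotropic_difference_def)
  then show "{card A | A. A \<subseteq> carrier_vec n \<and> no_isotropic_difference A} \<noteq> {}" by blast
qed

end

theory Submission
  imports Defs "HOL-Library.FuncSet"
begin

text \<open>Upper bound: for \<open>a \<in> A\<close> the function \<open>x \<mapsto> 1 - \<langle>x - a, x - a\<rangle>\<^sup>2\<close> restricts to the indicator of
  \<open>a\<close> on \<open>A\<close>.  As \<open>\<langle>x - a, x - a\<rangle>\<close> is a linear form in the \<open>n + 2\<close> functions
  \<open>x\<^sub>i, 1, \<langle>x,x\<rangle>\<close>, these indicators lie in the span of the pairwise products of those functions,
  and the product \<open>1 \<langle>x,x\<rangle>\<close> is redundant.  So all \<open>3 ^ card A\<close> functions on \<open>A\<close> arise from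
  coefficient families on \<open>((n + 3) choose 2) - 1\<close> monomials.

  Lower bound: if \<open>n mod 3 = 2\<close> and \<open>c\<close> is the all-one vector, then \<open>v\<^sub>i = e\<^sub>i\<close> together with
  \<open>v = - c\<close> are \<open>n + 1\<close> points at pairwise distance \<open>2\<close>, while \<open>c\<close> is orthogonal to all their
  differences and \<open>\<langle>c,c\<rangle> = 2\<close>.  The points \<open>- v\<^sub>i - v\<^sub>j\<close> (\<open>i < j\<close>), \<open>v\<^sub>i + c\<close> and \<open>v\<^sub>i - c\<close>
  have no isotropic differences.\<close>

text \<open>Declared as simp rules in the library, these unfold \<open>0\<close>, \<open>1\<close> and \<open>2\<close> to constructors and
  block ring normalisation.\<close>

declare zero_finite_3_def [simp del] one_finite_3_def [simp del] two_finite_3 [simp del]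

lemmas F3_arith = zero_finite_3_def one_finite_3_def plus_finite_3_def uminus_finite_3_def
  minus_finite_3_def times_finite_3_def

lemma F3_numerals [simp]: "(2 :: F3) = - 1" "(3 :: F3) = 0"
  by (simp_all add: numeral.simps F3_arith)

lemma F3_square: "(x :: F3) \<noteq> 0 \<Longrightarrow> x * x = 1"
  by (cases x; simp add: F3_arith)

definition dot :: "nat \<Rightarrow> (nat \<Rightarrow> F3) \<Rightarrow> (nat \<Rightarrow> F3) \<Rightarrow> F3" where
  "dot n f g = (\<Sum>i<n. f i * g i)"

lemma dot_bilinear:
  "dot n (\<lambda>i. f i + g i) h = dot n f h + dot n g h"
  "dot n h (\<lambda>i. f i + g i) = dot n h f + dot n h g"
  "dot n (\<lambda>i. f i - g i) h = dot n f h - dot n g h"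
  "dot n h (\<lambda>i. f i - g i) = dot n h f - dot n h g"
  "dot n (\<lambda>i. - f i) h = - dot n f h"
  "dot n h (\<lambda>i. - f i) = - dot n h f"
  "dot n (\<lambda>i. c * f i) h = c * dot n f h"
  "dot n h (\<lambda>i. c * f i) = c * dot n h f"
  by (simp_all add: dot_def algebra_simps sum.distrib sum_subtractf sum_negf sum_distrib_left)

lemma dot_commute: "dot n f g = dot n g f"
  by (simp add: dot_def mult.commute)

lemma scalar_prod_vec_diff:
  "scalar_prod (vec n f - vec n g) (vec n f - vec n g) = dot n (\<lambda>i. f i - g i) (\<lambda>i. f i - g i)"
  by (simp add: dot_def scalar_prod_def atLeast0LessThan)

text \<open>Both the monomials of the upper bound and the points of the extremal set are counted
  through this set.\<close>

lemma card_pairs_less: "card {(i, j). i < j \<and> j < (m :: nat)} = m choose 2"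
proof -
  have "{(i, j). i < j \<and> j < m} = (\<lambda>(j, i). (i, j)) ` Sigma {..<m} (\<lambda>j. {..<j})"
    by force
  then have "card {(i, j). i < j \<and> j < m} = card (Sigma {..<m} (\<lambda>j. {..<j}))"
    by (simp add: card_image inj_on_def split_def)
  also have "\<dots> = m choose 2"
    by (induction m) (simp_all add: numeral_2_eq_2 lessThan_Suc card_UN_disjoint)
  finally show ?thesis .
qed

section \<open>The upper bound\<close>

definition coord :: "nat \<Rightarrow> F3 vec \<Rightarrow> nat \<Rightarrow> F3" where
  "coord n x i = (if i < n then x $ i else if i = n then 1 else scalar_prod x x)"

definition monomial_pairs :: "nat \<Rightarrow> (nat \<times> nat) set" where
  "monomial_pairs n = {(i, j). i \<le> j \<and> j < n + 2} - {(n, n + 1)}"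

definition quad_span :: "nat \<Rightarrow> (F3 vec \<Rightarrow> F3) set" where
  "quad_span n = {F. \<exists>c. \<forall>x \<in> carrier_vec n.
     F x = (\<Sum>p\<in>monomial_pairs n. c p * (coord n x (fst p) * coord n x (snd p)))}"

lemma finite_monomial_pairs: "finite (monomial_pairs n)"
  by (rule finite_subset[of _ "{..n + 2} \<times> {..n + 2}"]) (auto simp: monomial_pairs_def)

lemma card_monomial_pairs: "card (monomial_pairs n) = ((n + 3) choose 2) - 1"
proof -
  \<comment> \<open>Raising the second index by one turns \<open>i \<le> j\<close> into a strict
    inequality.\<close>
  have "{(i, j). i < j \<and> j < n + 3} = (\<lambda>(i, j). (i, Suc j)) ` {(i, j). i \<le> j \<and> j < n + 2}"
  proof (safe, goal_cases)
    case (1 i j)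
    then show ?case by (cases j) auto
  qed auto
  then have "card {(i, j). i < j \<and> j < n + 3} = card {(i, j). i \<le> j \<and> j < n + 2}"
    by (simp add: card_image inj_on_def split_def)
  then show ?thesis
    by (simp add: monomial_pairs_def card_Diff_singleton card_pairs_less)
qed

lemma quad_span_add: "F \<in> quad_span n \<Longrightarrow> G \<in> quad_span n \<Longrightarrow> (\<lambda>x. F x + G x) \<in> quad_span n"
proof -
  assume "F \<in> quad_span n" "G \<in> quad_span n"
  then obtain c d where
    "\<forall>x \<in> carrier_vec n. F x = (\<Sum>p\<in>monomial_pairs n. c p * (coord n x (fst p) * coord n x (snd p)))"
    "\<forall>x \<in> carrier_vec n. G x = (\<Sum>p\<in>monomial_pairs n. d p * (coord n x (fst p) * coord n x (snd p)))"
    by (auto simp: quad_span_def)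
  then show ?thesis
    by (auto simp: quad_span_def sum.distrib[symmetric] distrib_right intro!: exI[of _ "\<lambda>p. c p + d p"])
qed

lemma quad_span_scale: "F \<in> quad_span n \<Longrightarrow> (\<lambda>x. a * F x) \<in> quad_span n"
proof -
  assume "F \<in> quad_span n"
  then obtain c where
    "\<forall>x \<in> carrier_vec n. F x = (\<Sum>p\<in>monomial_pairs n. c p * (coord n x (fst p) * coord n x (snd p)))"
    by (auto simp: quad_span_def)
  then show ?thesis
    by (auto simp: quad_span_def sum_distrib_left mult.assoc intro!: exI[of _ "\<lambda>p. a * c p"])
qed

lemma quad_span_zero: "(\<lambda>x. 0) \<in> quad_span n"
  by (auto simp: quad_span_def intro!: exI[of _ "\<lambda>p. 0"])

lemma quad_span_sum:
  "(\<And>i. i \<in> I \<Longrightarrow> F i \<in> quad_span n) \<Longrightarrow> (\<lambda>x. \<Sum>i\<in>I. F i x) \<in> quad_span n"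
  by (induction I rule: infinite_finite_induct) (simp_all add: quad_span_zero quad_span_add)

lemma quad_span_cong:
  "F \<in> quad_span n \<Longrightarrow> (\<And>x. x \<in> carrier_vec n \<Longrightarrow> F x = G x) \<Longrightarrow> G \<in> quad_span n"
  by (simp add: quad_span_def)

lemma quad_span_basis:
  assumes "(i, j) \<in> monomial_pairs n"
  shows "(\<lambda>x. coord n x i * coord n x j) \<in> quad_span n"
proof -
  have "(\<Sum>p\<in>monomial_pairs n. (if p = (i, j) then 1 else 0) * (coord n x (fst p) * coord n x (snd p)))
     = coord n x i * coord n x j" for x
    using assms by (subst sum.remove[OF finite_monomial_pairs assms]) (auto intro: sum.neutral)
  then show ?thesis
    unfolding quad_span_def by (auto intro!: exI[of _ "\<lambda>p. if p = (i, j) then 1 else 0"])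
qed

lemma quad_span_product:
  assumes "i < n + 2" "j < n + 2"
  shows "(\<lambda>x. coord n x i * coord n x j) \<in> quad_span n"
proof -
  have le: "(\<lambda>x. coord n x i * coord n x j) \<in> quad_span n" if "i \<le> j" "j < n + 2" for i j
  proof (cases "(i, j) = (n, n + 1)")
    case True
    \<comment> \<open>The relation \<open>1 \<cdot> \<langle>x,x\<rangle> = \<Sum> x\<^sub>i\<^sup>2\<close> saves one monomial.\<close>
    have "(\<lambda>x. \<Sum>k<n. coord n x k * coord n x k) \<in> quad_span n"
      by (intro quad_span_sum quad_span_basis) (auto simp: monomial_pairs_def)
    then show ?thesis
      by (rule quad_span_cong)
        (use True in \<open>auto simp: coord_def scalar_prod_def atLeast0LessThan\<close>)
  next
    case False
    then show ?thesis
      using that by (intro quad_span_basis) (auto simp: monomial_pairs_def)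
  qed
  show ?thesis
    using le[of i j] le[of j i] assms by (cases "i \<le> j") (auto simp: mult.commute)
qed

lemma quad_span_linear_square:
  "(\<lambda>x. (\<Sum>i<n + 2. a i * coord n x i) * (\<Sum>i<n + 2. a i * coord n x i)) \<in> quad_span n"
proof -
  have "(\<lambda>x. \<Sum>i<n + 2. \<Sum>j<n + 2. (a i * a j) * (coord n x i * coord n x j)) \<in> quad_span n"
    by (intro quad_span_sum quad_span_scale quad_span_product) auto
  then show ?thesis
    by (rule quad_span_cong) (simp only: sum_product, simp add: mult_ac)
qed

text \<open>Since \<open>- 2 = 1\<close>, expanding gives \<open>\<langle>x,x\<rangle> + \<langle>a,x\<rangle> + \<langle>a,a\<rangle>\<close>; the index \<open>2 * n + 1 - i\<close> swaps the
  last two coordinates \<open>n\<close> and \<open>n + 1\<close>.\<close>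

lemma distance_linear:
  assumes "a \<in> carrier_vec n" "x \<in> carrier_vec n"
  shows "scalar_prod (x - a) (x - a) =
    (\<Sum>i<n + 2. coord n a (if i < n then i else 2 * n + 1 - i) * coord n x i)"
proof -
  have eq: "(u - v) * (u - v) = u * u + v * v + v * u" for u v :: F3
    by (cases u; cases v; simp add: F3_arith)
  have "scalar_prod (x - a) (x - a) = (\<Sum>i<n. x $ i * x $ i + a $ i * a $ i + a $ i * x $ i)"
    using assms by (simp add: scalar_prod_def atLeast0LessThan eq)
  also have "\<dots> = scalar_prod x x + scalar_prod a a + (\<Sum>i<n. a $ i * x $ i)"
    using assms by (simp add: scalar_prod_def atLeast0LessThan sum.distrib)
  finally show ?thesis
    by (simp add: coord_def)
qed

lemma quad_span_indicator:
  assumes "a \<in> carrier_vec n"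
  shows "(\<lambda>x. 1 - scalar_prod (x - a) (x - a) * scalar_prod (x - a) (x - a)) \<in> quad_span n"
proof -
  define b where "b i = coord n a (if i < n then i else 2 * n + 1 - i)" for i
  \<comment> \<open>Coordinate \<open>n\<close> is constantly 1, so its square supplies the summand
    1.\<close>
  have "(\<lambda>x. coord n x n * coord n x n +
      (- 1) * ((\<Sum>i<n + 2. b i * coord n x i) * (\<Sum>i<n + 2. b i * coord n x i))) \<in> quad_span n"
    by (intro quad_span_add quad_span_scale quad_span_product quad_span_linear_square) auto
  then show ?thesis
    by (rule quad_span_cong) (simp add: distance_linear[OF assms] b_def coord_def del: sum.lessThan_Suc)
qed

lemma card_no_isotropic_difference_le:
  assumes A: "A \<subseteq> carrier_vec n" and no: "no_isotropic_difference A"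
  shows "card A \<le> ((n + 3) choose 2) - 1"
proof -
  have fin: "finite A"
    using A finite_carrier_vec_F3 by (rule finite_subset)
  define I where "I = monomial_pairs n"
  define ev where "ev c = restrict (\<lambda>x. \<Sum>p\<in>I. c p * (coord n x (fst p) * coord n x (snd p))) A"
    for c :: "nat \<times> nat \<Rightarrow> F3"
  \<comment> \<open>Counting replaces a dimension argument: this surjection yields
    \<open>3 ^ card A \<le> 3 ^ card I\<close>.\<close>
  have "A \<rightarrow>\<^sub>E (UNIV :: F3 set) \<subseteq> ev ` (I \<rightarrow>\<^sub>E UNIV)"
  proof
    fix g :: "F3 vec \<Rightarrow> F3" assume g: "g \<in> A \<rightarrow>\<^sub>E UNIV"
    define F where
      "F x = (\<Sum>a\<in>A. g a * (1 - scalar_prod (x - a) (x - a) * scalar_prod (x - a) (x - a)))" for x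
    have "F \<in> quad_span n"
      unfolding F_def using A by (intro quad_span_sum quad_span_scale quad_span_indicator) auto
    then obtain c where c: "\<And>x. x \<in> carrier_vec n \<Longrightarrow>
        F x = (\<Sum>p\<in>I. c p * (coord n x (fst p) * coord n x (snd p)))"
      by (auto simp: quad_span_def I_def)
    have Fg: "F x = g x" if "x \<in> A" for x
    proof -
      \<comment> \<open>For \<open>a \<noteq> x\<close> the distance is nonzero, hence squares to
        1.\<close>
      have "1 - scalar_prod (x - a) (x - a) * scalar_prod (x - a) (x - a) = (if a = x then 1 else 0)"
        if "a \<in> A" for a
        using no A that \<open>x \<in> A\<close> by (auto simp: no_isotropic_difference_def intro!: F3_square)
      then have "F x = (\<Sum>a\<in>A. if a = x then g a else 0)"
        unfolding F_def by (intro sum.cong) auto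
      then show ?thesis
        using fin that by simp
    qed
    have "ev (restrict c I) = g"
    proof
      fix x
      show "ev (restrict c I) x = g x"
        using g A Fg[of x] c[of x]
        by (cases "x \<in> A") (auto simp: ev_def PiE_def extensional_def)
    qed
    then show "g \<in> ev ` (I \<rightarrow>\<^sub>E UNIV)"
      by (metis image_eqI restrict_PiE_iff UNIV_I)
  qed
  moreover have finI: "finite I"
    by (simp add: I_def finite_monomial_pairs)
  ultimately have "card (A \<rightarrow>\<^sub>E (UNIV :: F3 set)) \<le> card (I \<rightarrow>\<^sub>E (UNIV :: F3 set))"
    by (meson surj_card_le finite_PiE finite)
  then have "(3::nat) ^ card A \<le> 3 ^ card I"
    by (simp add: card_funcsetE fin finI card_F3)
  then show ?thesis
    by (simp add: I_def card_monomial_pairs)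
qed

section \<open>The extremal set\<close>

definition simplex :: "nat \<Rightarrow> nat \<Rightarrow> nat \<Rightarrow> F3" where
  "simplex n i = (\<lambda>k. if i = n then - 1 else if k = i then 1 else 0)"

text \<open>A second index \<open>n + 1\<close> or \<open>n + 2\<close> is a marker for adding or
  subtracting the all-one vector; the removed pair consists of the two markers.\<close>

definition extremal_pairs :: "nat \<Rightarrow> (nat \<times> nat) set" where
  "extremal_pairs n = {(i, j). i < j \<and> j < n + 3} - {(n + 1, n + 2)}"

definition extremal_point :: "nat \<Rightarrow> nat \<times> nat \<Rightarrow> nat \<Rightarrow> F3" where
  "extremal_point n = (\<lambda>(i, j) k.
     if j \<le> n then - simplex n i k - simplex n j k
     else simplex n i k + (if j = n + 1 then 1 else - 1))"

lemma card_extremal_pairs: "card (extremal_pairs n) = ((n + 3) choose 2) - 1"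
  by (simp add: extremal_pairs_def card_Diff_singleton card_pairs_less)

context
  fixes n :: nat
  assumes n: "n mod 3 = 2"
begin

lemma of_nat_F3_eq: "of_nat n = (- 1 :: F3)"
proof -
  have "of_nat n = (of_nat (3 * (n div 3) + n mod 3) :: F3)"
    by simp
  also have "\<dots> = - 1"
    by (simp only: n of_nat_add of_nat_mult of_nat_numeral) simp
  finally show ?thesis .
qed

lemma dot_simplex_one: "i \<le> n \<Longrightarrow> dot n (simplex n i) (\<lambda>k. c) = c"
  using of_nat_F3_eq
  by (auto simp: dot_def simplex_def sum.If_cases sum_negf if_distrib[of "\<lambda>x. x * _"] cong: if_cong)

lemma dot_one_one: "dot n (\<lambda>k. c) (\<lambda>k. d) = - c * d"
  by (simp add: dot_def of_nat_F3_eq)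

text \<open>Polarisation with \<open>- 2 = 1\<close>: \<open>q i\<close> is the norm of the
  \<open>i\<close>-th simplex point, and the conditional term is the squared distance, 0 or
  \<open>2 = - 1\<close>.\<close>

lemma dot_simplex_simplex:
  assumes "i \<le> n" "j \<le> n"
  defines "q \<equiv> \<lambda>i. if i = n then - 1 else (1 :: F3)"
  shows "dot n (simplex n i) (simplex n j) = (if i = j then 0 else - 1) - q i - q j"
proof -
  have last: "simplex n n = (\<lambda>k. - 1)"
    by (simp add: simplex_def)
  consider "j = n" | "i = n" "j < n" | "i < n" "j < n"
    using assms by linarith
  then show ?thesis
  proof cases
    case 1
    then show ?thesis
      using assms dot_simplex_one[of i "-1"] by (auto simp: last q_def)
  next
    case 2
    then show ?thesis
      using dot_simplex_one[of j "-1"] by (auto simp: last q_def dot_commute)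
  next
    case 3
    have "dot n (simplex n i) (simplex n j) = (\<Sum>k<n. if k = i then if i = j then 1 else 0 else 0)"
      unfolding dot_def using 3 by (intro sum.cong) (auto simp: simplex_def)
    then show ?thesis
      using 3 by (auto simp: q_def)
  qed
qed

text \<open>As \<open>3 = 0\<close>, each difference is a combination of differences of simplex
  points, plus 0 or a sign times the all-one vector, to which these are orthogonal. Without the
  latter the norm is 1 or -1; otherwise the first part has norm 0 or -1 and the second adds
  -1.\<close>

lemma extremal_points_anisotropic:
  assumes "s \<in> extremal_pairs n" "t \<in> extremal_pairs n" "s \<noteq> t"
  shows "dot n (\<lambda>k. extremal_point n s k - extremal_point n t k)
           (\<lambda>k. extremal_point n s k - extremal_point n t k) \<noteq> 0"
proof -
  obtain i j k l where st: "s = (i, j)" "t = (k, l)"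
    by (cases s; cases t) auto
  note ev = dot_bilinear dot_simplex_one dot_simplex_one[unfolded dot_commute[of n "simplex n _"]]
    dot_one_one dot_simplex_simplex
  have i: "i \<le> n" "i < j" "j \<le> n + 2" and k: "k \<le> n" "k < l" "l \<le> n + 2"
    using assms by (auto simp: st extremal_pairs_def)
  consider "j \<le> n" "l \<le> n" | "j \<le> n" "l > n" | "j > n" "l \<le> n" | "j > n" "l > n"
    by linarith
  then show ?thesis
  proof cases
    case 1
    then show ?thesis
      using i k assms(3) unfolding st extremal_point_def
      by (simp add: ev; auto simp: F3_arith)
  next
    case 2
    then show ?thesis
      using i k assms(3) unfolding st extremal_point_def
      by (simp add: ev; auto simp: F3_arith)
  next
    case 3
    then show ?thesis
      using i k assms(3) unfolding st extremal_point_def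
      by (simp add: ev; auto simp: F3_arith)
  next
    case 4
    then have "j = n + 1 \<or> j = n + 2" "l = n + 1 \<or> l = n + 2"
      using i k by auto
    then show ?thesis
      using i k assms(3)
      by (elim disjE; simp add: st extremal_point_def ev; auto simp: F3_arith)
  qed
qed

lemma ex_no_isotropic_difference:
  "\<exists>A \<subseteq> carrier_vec n. no_isotropic_difference A \<and> card A = ((n + 3) choose 2) - 1"
proof -
  define p where "p s = vec n (extremal_point n s)" for s
  have p: "scalar_prod (p s - p t) (p s - p t) \<noteq> 0"
    if "s \<in> extremal_pairs n" "t \<in> extremal_pairs n" "s \<noteq> t" for s t
    unfolding p_def scalar_prod_vec_diff by (rule extremal_points_anisotropic[OF that])
  \<comment> \<open>Coinciding points would have difference zero, which is isotropic.\<close>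
  have "inj_on p (extremal_pairs n)"
  proof (rule inj_onI, rule ccontr)
    fix s t assume st: "s \<in> extremal_pairs n" "t \<in> extremal_pairs n" "p s = p t" "s \<noteq> t"
    have "scalar_prod (p s - p t) (p s - p t) = 0"
      unfolding st(3) unfolding p_def scalar_prod_vec_diff by (simp add: dot_def)
    then show False
      using p st by blast
  qed
  then have "card (p ` extremal_pairs n) = ((n + 3) choose 2) - 1"
    by (simp add: card_image card_extremal_pairs)
  moreover have "no_isotropic_difference (p ` extremal_pairs n)"
    using p by (auto simp: no_isotropic_difference_def)
  moreover have "p ` extremal_pairs n \<subseteq> carrier_vec n"
    by (auto simp: p_def)
  ultimately show ?thesis
    by blast
qed

end

theorem theorem1p7:
  fixes n :: nat
  assumes "n > 0" and "[n = 2] (mod 3)"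
  shows "S3 n = ((n + 3) choose 2) - 1"
  unfolding S3_def
proof (rule Max_eqI)
  show "((n + 3) choose 2) - 1 \<in> {card A | A. A \<subseteq> carrier_vec n \<and> no_isotropic_difference A}"
  proof -
    have "n mod 3 = 2"
      using assms(2) by (simp add: cong_def)
    then show ?thesis
      using ex_no_isotropic_difference[of n] by (metis (mono_tags, lifting) mem_Collect_eq)
  qed
qed (auto simp: S3_Max_well_defined card_no_isotropic_difference_le simp del: One_nat_def)

end
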